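(* Let $\Bbbk$ be a field of characteristic zero, $H=\Bbbk[\partial]$, and let $V=\mathrm{Cur}_1$ or $V=\mathcal V_\alpha$ with $\alpha\in\Bbbk$. Then the Novikov conformal algebra $V$ has no nontrivial extensions by means of the scalar module $M=\Bbbk e$, $\partial e=0$.
   Context: A conformal algebra is an $H$-module $V$ with a $\Bbbk$-bilinear operation $V\times V\to V[\lambda]$, $(a,b)\mapsto a\circ_{(\lambda)}b$, which is sesqui-linear: $(\partial a)\circ_{(\lambda)}b=-\lambda(a\circ_{(\lambda)}b)$, $a\circ_{(\lambda)}(\partial b)=(\partial+\lambda)(a\circ_{(\lambda)}b)$. If $a\circ_{(\lambda)}b=\sum_n\lambda^n c_n$, put $\{a\circ_{(\lambda)}b\}=a\circ_{(-\partial-\lambda)}b:=\sum_n(-\partial-\lambda)^nc_n$. It is a Novikov conformal algebra if for all $a,b,c\in V$ (products extended coefficientwise) $$(a\circ_{(\lambda)}b)\circ_{(\lambda+\mu)}c-a\circ_{(\lambda)}(b\circ_{(\mu)}c)=(b\circ_{(\mu)}a)\circ_{(\lambda+\mu)}c-b\circ_{(\mu)}(a\circ_{(\lambda)}c),$$ $$(a\circ_{(\lambda)}b)\circ_{(\mu)}c=\{(a\circ_{(\lambda)}c)\circ_{(\mu-\lambda)}b\}.$$ $\mathrm{Cur}_1$ is the free $H$-module $Hv$ of rank one with $v\circ_{(\lambda)}v=v$; $\mathcal V_\alpha$ is the free $H$-module $Hv$ of rank one with $v\circ_{(\lambda)}v=(\partial+\lambda+\alpha)v$. The scalar module $M=\Bbbk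 e$, $\partial e=0$, is a conformal bimodule over $V$ with $u\circ_{(\lambda)}e=e\circ_{(\lambda)}u=0$ for all $u\in V$. An extension of $V$ by means of $M$ is an exact sequence $0\to M\to E\to V\to0$ of Novikov conformal algebras with $M\circ_{(\lambda)}M=0$ in $E$ (inducing this bimodule structure). Its structure is determined by a $\Bbbk$-bilinear map $f_\lambda:V\otimes V\to M[\lambda]$ (so that $E=V\oplus M$ with product $u\circ_{(\lambda)}v+f_\lambda(u,v)$ for $u,v\in V$) satisfying, for all $u,v,w\in V$, $$f_\lambda(\partial u,v)=-\lambda f_\lambda(u,v),\qquad f_\lambda(u,\partial v)=\lambda f_\lambda(u,v),$$ $$f_{\lambda+\mu}(u\circ_{(\lambda)}v,w)-f_\lambda(u,v\circ_{(\mu)}w)=f_{\lambda+\mu}(v\circ_{(\mu)}u,w)-f_\mu(v,u\circ_{(\lambda)}w),$$ $$f_{\lambda+\mu}(u\circ_{(\lambda)}v,w)=f_{-\partial-\mu}(u\circ_{(\lambda)}w,v),$$ where maps are extended coefficientwise to polynomials and $\partial$ acts on $M$ by zero. Two extensions $E,E'$ given by $f,f'$ are equivalent if there is an isomorphism of conformal algebras $E\to E'$ which is the identity on $M$ (and induces the identity on $V$); this is the case if and only if $f_\lambda(u,v)-f'_\lambda(u,v)=(d^1g)_\lambda(u,v):=g(u\circ_{(\lambda)}v)$ for some $H$-linear map $g:V\to M$ (extended coefficientwise in $\lambda$). An extension is trivial if it is equivalent to the one with $f=0$, i.e. if $f=d^1g$ for some $H$-linear $g:V\to M$. *)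

theory Defs
  imports "HOL-Computational_Algebra.Polynomial" "HOL-Library.Product_Plus"
begin

text \<open>
  \<open>'k poly\<close> is \<open>H = k[\<partial>]\<close>, and an \<open>H\<close>-module is given by a scalar multiplication of
  \<open>'k poly\<close> on an abelian group (the library locale \<open>module\<close>).  For a module \<open>V\<close> of type
  \<open>'v\<close>, the type \<open>'v poly\<close> is \<open>V[\<lambda>]\<close> and \<open>'v poly poly\<close> is \<open>V[\<lambda>,\<mu>] = V[\<lambda>][\<mu>]\<close>, so that
  \<open>coeff (coeff A j) i\<close> is the coefficient of \<open>\<lambda>^i \<mu>^j\<close>.  Likewise \<open>'k poly poly\<close> is
  \<open>H[\<lambda>]\<close> and \<open>'k poly poly poly\<close> is \<open>H[\<lambda>,\<mu>]\<close>.
\<close>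

definition del :: "'k::comm_ring_1 poly poly poly" where
  "del = [:[:[:0, 1:]:]:]"

definition lam :: "'k::comm_ring_1 poly poly poly" where
  "lam = [:[:0, 1:]:]"

definition mu :: "'k::comm_ring_1 poly poly poly" where
  "mu = [:0, 1:]"

text \<open>The action of \<open>R[t]\<close> on \<open>V[t]\<close> extending an action of \<open>R\<close> on \<open>V\<close>.\<close>

definition poly_scale ::
  "('r::zero \<Rightarrow> 'v::comm_monoid_add \<Rightarrow> 'v) \<Rightarrow> 'r poly \<Rightarrow> 'v poly \<Rightarrow> 'v poly" where
  "poly_scale s p q =
     (\<Sum>i\<le>degree p. \<Sum>j\<le>degree q. monom (s (coeff p i) (coeff q j)) (i + j))"

abbreviation poly2_scale ::
  "('r::zero \<Rightarrow> 'v::comm_monoid_add \<Rightarrow> 'v) \<Rightarrow> 'r poly poly \<Rightarrow> 'v poly poly \<Rightarrow> 'v poly poly" where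
  "poly2_scale s \<equiv> poly_scale (poly_scale s)"

text \<open>The substitution \<open>\<Sum> \<lambda>^n c\<^sub>n \<mapsto> \<Sum> z^n c\<^sub>n\<close> for \<open>z \<in> H[\<lambda>,\<mu>]\<close>; here \<open>z\<close> may involve
  \<open>\<partial>\<close>, which acts on the coefficients \<open>c\<^sub>n\<close>.\<close>

definition subst_lambda ::
  "('k::comm_ring_1 poly \<Rightarrow> 'v::ab_group_add \<Rightarrow> 'v) \<Rightarrow> 'k poly poly poly \<Rightarrow> 'v poly
    \<Rightarrow> 'v poly poly" where
  "subst_lambda s z q = (\<Sum>n\<le>degree q. poly2_scale s (z ^ n) [:[:coeff q n:]:])"

text \<open>The product \<open>A \<circ>\<^sub>(\<^sub>z\<^sub>) B\<close> of \<open>A, B \<in> V[\<lambda>,\<mu>]\<close>, extended coefficientwise from \<open>V\<close>.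
  With \<open>z = - del - w\<close> this is the product written \<open>{A \<circ>\<^sub>(\<^sub>w\<^sub>) B}\<close>.\<close>

definition ext_prod ::
  "('k::comm_ring_1 poly \<Rightarrow> 'v::ab_group_add \<Rightarrow> 'v) \<Rightarrow> ('v \<Rightarrow> 'v \<Rightarrow> 'v poly)
    \<Rightarrow> 'k poly poly poly \<Rightarrow> 'v poly poly \<Rightarrow> 'v poly poly \<Rightarrow> 'v poly poly" where
  "ext_prod s P z A B =
     (\<Sum>j\<le>degree A. \<Sum>i\<le>degree (coeff A j). \<Sum>l\<le>degree B. \<Sum>k\<le>degree (coeff B l).
        poly2_scale s (lam ^ (i + k) * mu ^ (j + l))
          (subst_lambda s z (P (coeff (coeff A j) i) (coeff (coeff B l) k))))"

locale conformal_algebra =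
  module scale for scale :: "'k::field poly \<Rightarrow> 'v::ab_group_add \<Rightarrow> 'v" +
  fixes lprod :: "'v \<Rightarrow> 'v \<Rightarrow> 'v poly"
  assumes lprod_add_left: "lprod (a + a') b = lprod a b + lprod a' b"
    and lprod_add_right: "lprod a (b + b') = lprod a b + lprod a b'"
    and lprod_const_left: "lprod (scale [:c:] a) b = map_poly (scale [:c:]) (lprod a b)"
    and lprod_const_right: "lprod a (scale [:c:] b) = map_poly (scale [:c:]) (lprod a b)"
    and sesqui_left: "lprod (scale [:0, 1:] a) b = - pCons 0 (lprod a b)"
    and sesqui_right:
      "lprod a (scale [:0, 1:] b) = map_poly (scale [:0, 1:]) (lprod a b) + pCons 0 (lprod a b)"
begin

abbreviation at_prod :: "'v poly poly \<Rightarrow> 'k poly poly poly \<Rightarrow> 'v poly poly \<Rightarrow> 'v poly poly"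
    (\<open>_ \<circ>[_] _\<close> [76, 0, 76] 75) where
  "A \<circ>[z] B \<equiv> ext_prod scale lprod z A B"

abbreviation const :: "'v \<Rightarrow> 'v poly poly" where
  "const a \<equiv> [:[:a:]:]"

end

locale novikov_conformal_algebra = conformal_algebra +
  assumes left_symmetric:
      "(const a \<circ>[lam] const b) \<circ>[lam + mu] const c - const a \<circ>[lam] (const b \<circ>[mu] const c)
       = (const b \<circ>[mu] const a) \<circ>[lam + mu] const c - const b \<circ>[mu] (const a \<circ>[lam] const c)"
    and right_commutative:
      "(const a \<circ>[lam] const b) \<circ>[mu] const c
       = (const a \<circ>[lam] const c) \<circ>[- del - (mu - lam)] const b"

definition conformal_hom ::
  "('k::field poly \<Rightarrow> 'a::ab_group_add \<Rightarrow> 'a) \<Rightarrow> ('a \<Rightarrow> 'a \<Rightarrow> 'a poly) \<Rightarrow>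
   ('k poly \<Rightarrow> 'b::ab_group_add \<Rightarrow> 'b) \<Rightarrow> ('b \<Rightarrow> 'b \<Rightarrow> 'b poly) \<Rightarrow> ('a \<Rightarrow> 'b) \<Rightarrow> bool" where
  "conformal_hom sA pA sB pB \<phi> \<longleftrightarrow>
     module_hom sA sB \<phi> \<and> (\<forall>x y. pB (\<phi> x) (\<phi> y) = map_poly \<phi> (pA x y))"

text \<open>An extension \<open>0 \<rightarrow> M \<rightarrow> E \<rightarrow> V \<rightarrow> 0\<close> with maps \<open>\<iota>\<close> and \<open>\<pi>\<close>, where \<open>M\<close> carries the zero
  product and \<open>lact\<close>, \<open>ract\<close> are the left and right actions of \<open>V\<close> on the bimodule \<open>M\<close>.\<close>

locale conformal_extension =
  V: novikov_conformal_algebra sV pV +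
  E: novikov_conformal_algebra sE pE
  for sV :: "'k::field poly \<Rightarrow> 'v::ab_group_add \<Rightarrow> 'v" and pV :: "'v \<Rightarrow> 'v \<Rightarrow> 'v poly"
    and sM :: "'k poly \<Rightarrow> 'm::ab_group_add \<Rightarrow> 'm"
    and lact :: "'v \<Rightarrow> 'm \<Rightarrow> 'm poly" and ract :: "'m \<Rightarrow> 'v \<Rightarrow> 'm poly"
    and sE :: "'k poly \<Rightarrow> 'e::ab_group_add \<Rightarrow> 'e" and pE :: "'e \<Rightarrow> 'e \<Rightarrow> 'e poly"
    and \<iota> :: "'m \<Rightarrow> 'e" and \<pi> :: "'e \<Rightarrow> 'v" +
  assumes hom_\<iota>: "conformal_hom sM (\<lambda>_ _. 0) sE pE \<iota>"
    and hom_\<pi>: "conformal_hom sE pE sV pV \<pi>"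
    and inj_\<iota>: "inj \<iota>"
    and exact: "range \<iota> = {x. \<pi> x = 0}"
    and surj_\<pi>: "surj \<pi>"
    and induced_left: "pE x (\<iota> m) = map_poly \<iota> (lact (\<pi> x) m)"
    and induced_right: "pE (\<iota> m) x = map_poly \<iota> (ract m (\<pi> x))"

definition equivalent_extensions ::
  "('k::field poly \<Rightarrow> 'e::ab_group_add \<Rightarrow> 'e) \<Rightarrow> ('e \<Rightarrow> 'e \<Rightarrow> 'e poly) \<Rightarrow>
   ('m \<Rightarrow> 'e) \<Rightarrow> ('e \<Rightarrow> 'v) \<Rightarrow>
   ('k poly \<Rightarrow> 'f::ab_group_add \<Rightarrow> 'f) \<Rightarrow> ('f \<Rightarrow> 'f \<Rightarrow> 'f poly) \<Rightarrow>
   ('m \<Rightarrow> 'f) \<Rightarrow> ('f \<Rightarrow> 'v) \<Rightarrow> bool" where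
  "equivalent_extensions sE pE \<iota> \<pi> sF pF \<iota>' \<pi>' \<longleftrightarrow>
     (\<exists>\<phi>. bij \<phi> \<and> conformal_hom sE pE sF pF \<phi> \<and> \<phi> \<circ> \<iota> = \<iota>' \<and> \<pi>' \<circ> \<phi> = \<pi>)"

text \<open>The extension \<open>V \<oplus> M\<close> given by the zero cocycle.\<close>

definition split_scale ::
  "('k poly \<Rightarrow> 'v \<Rightarrow> 'v) \<Rightarrow> ('k poly \<Rightarrow> 'm \<Rightarrow> 'm) \<Rightarrow> 'k::field poly \<Rightarrow> 'v \<times> 'm \<Rightarrow> 'v \<times> 'm" where
  "split_scale sV sM p x = (sV p (fst x), sM p (snd x))"

definition split_prod ::
  "('v \<Rightarrow> 'v \<Rightarrow> 'v poly) \<Rightarrow> ('v \<Rightarrow> 'm \<Rightarrow> 'm poly) \<Rightarrow> ('m \<Rightarrow> 'v \<Rightarrow> 'm poly) \<Rightarrow>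
   'v::ab_group_add \<times> 'm::ab_group_add \<Rightarrow> 'v \<times> 'm \<Rightarrow> ('v \<times> 'm) poly" where
  "split_prod pV lact ract x y =
     map_poly (\<lambda>u. (u, 0)) (pV (fst x) (fst y)) +
     map_poly (\<lambda>m. (0, m)) (lact (fst x) (snd y) + ract (snd x) (fst y))"

definition trivial_extension ::
  "('k::field poly \<Rightarrow> 'v::ab_group_add \<Rightarrow> 'v) \<Rightarrow> ('v \<Rightarrow> 'v \<Rightarrow> 'v poly) \<Rightarrow>
   ('k poly \<Rightarrow> 'm::ab_group_add \<Rightarrow> 'm) \<Rightarrow> ('v \<Rightarrow> 'm \<Rightarrow> 'm poly) \<Rightarrow> ('m \<Rightarrow> 'v \<Rightarrow> 'm poly) \<Rightarrow>
   ('k poly \<Rightarrow> 'e::ab_group_add \<Rightarrow> 'e) \<Rightarrow> ('e \<Rightarrow> 'e \<Rightarrow> 'e poly) \<Rightarrow>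
   ('m \<Rightarrow> 'e) \<Rightarrow> ('e \<Rightarrow> 'v) \<Rightarrow> bool" where
  "trivial_extension sV pV sM lact ract sE pE \<iota> \<pi> \<longleftrightarrow>
     equivalent_extensions sE pE \<iota> \<pi>
       (split_scale sV sM) (split_prod pV lact ract) (\<lambda>m. (0, m)) fst"

text \<open>The free \<open>H\<close>-module \<open>Hv\<close> of rank one is \<open>'k poly\<close> acting on itself by multiplication, with
  \<open>v = 1\<close>.  By sesqui-linearity, \<open>v \<circ>\<^sub>(\<^sub>\<lambda>\<^sub>) v = w(\<partial>,\<lambda>) v\<close> forces
  \<open>a(\<partial>)v \<circ>\<^sub>(\<^sub>\<lambda>\<^sub>) b(\<partial>)v = a(-\<lambda>) b(\<partial>+\<lambda>) w(\<partial>,\<lambda>) v\<close>.\<close>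

definition rank_one_prod ::
  "'k::field poly poly \<Rightarrow> 'k poly \<Rightarrow> 'k poly \<Rightarrow> 'k poly poly" where
  "rank_one_prod w a b =
     poly (map_poly (\<lambda>c. [:[:c:]:]) a) (- [:0, 1:]) *
     poly (map_poly (\<lambda>c. [:[:c:]:]) b) ([:[:0, 1:]:] + [:0, 1:]) * w"

definition Cur1_prod :: "'k::field poly \<Rightarrow> 'k poly \<Rightarrow> 'k poly poly" where
  "Cur1_prod = rank_one_prod 1"

definition V_prod :: "'k::field \<Rightarrow> 'k poly \<Rightarrow> 'k poly \<Rightarrow> 'k poly poly" where
  "V_prod \<alpha> = rank_one_prod ([:[:0, 1:]:] + [:0, 1:] + [:[:\<alpha>:]:])"

text \<open>The scalar module \<open>k e\<close> with \<open>\<partial> e = 0\<close>.\<close>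

definition scalar_scale :: "'k::field poly \<Rightarrow> 'k \<Rightarrow> 'k" where
  "scalar_scale p m = poly p 0 * m"

end

theory Submission
  imports Defs
begin

text \<open>
  Write the product of the generator as \<open>v \<circ>\<^sub>(\<^sub>\<lambda>\<^sub>) v = h(\<partial> + \<lambda>) v\<close>, with \<open>h = 1\<close> for \<open>Cur\<^sub>1\<close> and
  \<open>h(t) = t + \<alpha>\<close> for \<open>V\<^sub>\<alpha>\<close>.  Since \<open>Hv\<close> is free, a preimage \<open>e\<close> of \<open>v\<close> in an extension \<open>E\<close> gives
  an \<open>H\<close>-linear splitting \<open>E = He \<oplus> M\<close>, and \<open>e \<circ>\<^sub>(\<^sub>\<lambda>\<^sub>) e = h(\<partial> + \<lambda>) e + f(\<lambda>)\<close> for some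
  \<open>f \<in> k[\<lambda>]\<close>; by sesqui-linearity \<open>f\<close> is all there is to know about the extension.

  Right commutativity determines \<open>f\<close> up to a scalar.  In
  \<open>(e \<circ>\<^sub>(\<^sub>\<lambda>\<^sub>) e) \<circ>\<^sub>(\<^sub>\<mu>\<^sub>) e = {(e \<circ>\<^sub>(\<^sub>\<lambda>\<^sub>) e) \<circ>\<^sub>(\<^sub>\<mu>\<^sub>-\<^sub>\<lambda>\<^sub>) e}\<close> the summand \<open>f(\<lambda>)\<close> of the inner product is
  annihilated, and comparing the components in \<open>M\<close>, on which \<open>\<partial> = 0\<close>, gives
  \<open>h(\<lambda> - \<mu>) f(\<mu>) = h(\<mu>) f(\<lambda> - \<mu>)\<close>.  As \<open>\<lambda> - \<mu>\<close> and \<open>\<mu>\<close> are independent, choosing a value of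
  \<open>\<lambda> - \<mu>\<close> at which \<open>h\<close> does not vanish shows that \<open>f = c h\<close> for a scalar \<open>c\<close>
  (\<open>cocycle_identity\<close>, \<open>trivial_if_product_of_sum\<close>).  Then \<open>e + c\<close> is another preimage of \<open>v\<close>, and
  \<open>h(\<partial> + \<lambda>) (e + c) = h(\<partial> + \<lambda>) e + c h(\<lambda>)\<close> is precisely its product with itself; so \<open>H(e + c)\<close>
  is a subalgebra that splits the extension (\<open>trivial_if_multiplicative_lift\<close>).

  The identity above is obtained at numerical values of \<open>\<lambda>\<close> and \<open>\<mu>\<close>.  Substituting numbers into
  elements of \<open>E[\<lambda>,\<mu>]\<close> turns the products of polynomials into honest biadditive products on \<open>E\<close>
  (\<open>eval2_at_prod\<close>), so that right commutativity becomes an identity in \<open>E\<close>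
  (\<open>right_commutative_at\<close>).  A field of characteristic zero is infinite, so no information about
  polynomials is lost.
\<close>

section \<open>Evaluation of polynomials with coefficients in a module\<close>

lemma poly_altdef_upto:
  fixes x :: "'a::comm_semiring_1"
  assumes "degree p \<le> N"
  shows "poly p x = (\<Sum>n\<le>N. coeff p n * x ^ n)"
  unfolding poly_altdef
  by (rule sum.mono_neutral_left) (use assms in \<open>auto simp: coeff_eq_0\<close>)

locale module_evaluation = module scale
  for scale :: "'a::comm_ring_1 \<Rightarrow> 'b::ab_group_add \<Rightarrow> 'b"
begin

text \<open>
  The map \<open>T\<close> evaluates the coefficients before \<open>r\<close> is substituted.  Taking for \<open>T\<close> the evaluation
  of \<open>V[\<lambda>]\<close> gives the evaluation of \<open>V[\<lambda>,\<mu>] = V[\<lambda>][\<mu>]\<close>, directly over \<open>H\<close> instead of over \<open>H[\<lambda>]\<close>.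
\<close>

definition eval_via :: "'a \<Rightarrow> ('w::zero \<Rightarrow> 'b) \<Rightarrow> 'w poly \<Rightarrow> 'b" where
  "eval_via r T q = (\<Sum>n\<le>degree q. scale (r ^ n) (T (coeff q n)))"

lemma eval_via_upto:
  assumes "T 0 = 0" and "degree q \<le> N"
  shows "eval_via r T q = (\<Sum>n\<le>N. scale (r ^ n) (T (coeff q n)))"
  unfolding eval_via_def
  by (rule sum.mono_neutral_left) (use assms in \<open>auto simp: coeff_eq_0\<close>)

lemma additive_eval_via:
  fixes T :: "'w::ab_group_add \<Rightarrow> 'b"
  assumes "additive T"
  shows "additive (eval_via r T)"
proof
  fix p q :: "'w poly"
  interpret T: additive T by fact
  let ?N = "max (degree p) (degree q)"
  have "degree (p + q) \<le> ?N"
    by (rule degree_add_le) auto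
  then show "eval_via r T (p + q) = eval_via r T p + eval_via r T q"
    by (simp add: eval_via_upto[where N = ?N] T.zero T.add scale_right_distrib sum.distrib)
qed

lemma eval_via_monom:
  assumes "T 0 = 0"
  shows "eval_via r T (monom x n) = scale (r ^ n) (T x)"
proof -
  have "eval_via r T (monom x n) = (\<Sum>k\<le>n. if k = n then scale (r ^ n) (T x) else 0)"
    unfolding eval_via_upto[of T, OF assms degree_monom_le]
    by (rule sum.cong) (auto simp: assms)
  then show ?thesis by simp
qed

lemma eval_via_const:
  "T 0 = 0 \<Longrightarrow> eval_via r T [:x:] = T x"
  by (simp add: eval_via_def)

text \<open>
  Evaluation is semilinear, with \<open>\<chi>\<close> the evaluation of the coefficients that goes with \<open>T\<close>.  The
  lemma is applied twice: with \<open>T\<close> the identity, and then with \<open>T\<close> the evaluation so obtained.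
\<close>

lemma eval_via_poly_scale:
  fixes T :: "'w::ab_group_add \<Rightarrow> 'b"
  assumes "additive T" and T_scale: "\<And>p w. T (s p w) = scale (\<chi> p) (T w)"
  shows "eval_via r T (poly_scale s P Q) =
           scale (\<Sum>i\<le>degree P. \<chi> (coeff P i) * r ^ i) (eval_via r T Q)"
proof -
  interpret T: additive T by fact
  interpret ev: additive "eval_via r T" by (rule additive_eval_via) fact
  have "eval_via r T (poly_scale s P Q) =
      (\<Sum>i\<le>degree P. \<Sum>j\<le>degree Q. scale (r ^ (i + j)) (scale (\<chi> (coeff P i)) (T (coeff Q j))))"
    by (simp add: poly_scale_def ev.sum eval_via_monom T.zero T_scale)
  also have "\<dots> = (\<Sum>i\<le>degree P. scale (\<chi> (coeff P i) * r ^ i) (eval_via r T Q))"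
    by (simp add: eval_via_def scale_sum_right power_add ac_simps)
  also have "\<dots> = scale (\<Sum>i\<le>degree P. \<chi> (coeff P i) * r ^ i) (eval_via r T Q)"
    by (simp add: scale_sum_left)
  finally show ?thesis .
qed

abbreviation eval_at :: "'a \<Rightarrow> 'b poly \<Rightarrow> 'b" where
  "eval_at r \<equiv> eval_via r (\<lambda>x. x)"

lemma additive_eval_at: "additive (eval_at r)"
  by (rule additive_eval_via) (simp add: additive_def)

lemma eval_at_poly_scale:
  "eval_at r (poly_scale scale p q) = scale (poly p r) (eval_at r q)"
  by (subst eval_via_poly_scale[where \<chi> = "\<lambda>a. a"])
    (simp_all add: additive_def poly_altdef)

lemma eval_at_pCons: "eval_at r (pCons a q) = a + scale r (eval_at r q)"
proof -
  have "eval_at r (pCons a q) = (\<Sum>n\<le>Suc (degree q). scale (r ^ n) (coeff (pCons a q) n))"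
    by (rule eval_via_upto) (simp_all add: degree_pCons_le)
  also have "\<dots> = a + (\<Sum>n\<le>degree q. scale (r ^ Suc n) (coeff q n))"
    by (subst sum.atMost_Suc_shift) simp
  finally show ?thesis
    by (simp add: eval_via_def scale_sum_right)
qed

abbreviation eval2_at :: "'a \<Rightarrow> 'a \<Rightarrow> 'b poly poly \<Rightarrow> 'b" where
  "eval2_at l m \<equiv> eval_via m (eval_at l)"

lemma additive_eval2_at: "additive (eval2_at l m)"
  by (intro additive_eval_via additive_eval_at)

lemma eval2_at_const: "eval2_at l m [:[:x:]:] = x"
  by (simp add: eval_via_const additive.zero[OF additive_eval_at])

lemma eval2_at_poly2_scale:
  "eval2_at l m (poly2_scale scale p A) = scale (poly (poly p [:m:]) l) (eval2_at l m A)"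
proof -
  have "(\<Sum>i\<le>degree p. poly (coeff p i) l * m ^ i) = poly (poly p [:m:]) l"
    by (simp add: poly_altdef[of p] poly_sum)
  then show ?thesis
    by (subst eval_via_poly_scale[where \<chi> = "\<lambda>p. poly p l"])
      (simp_all add: additive_eval_at eval_at_poly_scale)
qed

end

section \<open>The numerical products of a conformal algebra\<close>

sublocale conformal_algebra \<subseteq> module_evaluation scale
  by unfold_locales

context conformal_algebra
begin

text \<open>
  This is \<open>a \<circ>\<^sub>(\<^sub>h\<^sub>) b\<close> for \<open>h \<in> H = k[\<partial>]\<close>.  Allowing \<open>h\<close> to involve \<open>\<partial>\<close> covers the products
  \<open>{a \<circ>\<^sub>(\<^sub>w\<^sub>) b}\<close> as well, with \<open>h = - \<partial> - w\<close>.
\<close>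

definition prod_at :: "'k poly \<Rightarrow> 'v \<Rightarrow> 'v \<Rightarrow> 'v" where
  "prod_at h a b = eval_at h (lprod a b)"

lemma additive_prod_at_left: "additive (\<lambda>a. prod_at h a b)"
  by (simp add: additive_def prod_at_def lprod_add_left additive.add[OF additive_eval_at])

lemma additive_prod_at_right: "additive (\<lambda>b. prod_at h a b)"
  by (simp add: additive_def prod_at_def lprod_add_right additive.add[OF additive_eval_at])

lemma eval_at_map_scale: "eval_at h (map_poly (scale p) q) = scale p (eval_at h q)"
proof -
  have "degree (map_poly (scale p) q) \<le> degree q"
    by (rule map_poly_degree_leq)
  from eval_via_upto[OF _ this, of "\<lambda>x. x" h] show ?thesis
    by (simp add: coeff_map_poly eval_via_def scale_sum_right mult.commute)
qed

lemma prod_at_const_left: "prod_at h (scale [:c:] a) b = scale [:c:] (prod_at h a b)"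
  by (simp add: prod_at_def lprod_const_left eval_at_map_scale)

lemma prod_at_const_right: "prod_at h a (scale [:c:] b) = scale [:c:] (prod_at h a b)"
  by (simp add: prod_at_def lprod_const_right eval_at_map_scale)

text \<open>
  Iterated left sesqui-linearity: \<open>\<partial>\<close> on the left factor acts as \<open>- h\<close>.
\<close>

lemma prod_at_scale_left:
  "prod_at h (scale p a) b = scale (pcompose p (- h)) (prod_at h a b)"
proof (induction p)
  case 0
  then show ?case by (simp add: additive.zero[OF additive_prod_at_left])
next
  case (pCons c p)
  have "scale (pCons c p) a = scale [:c:] a + scale [:0, 1:] (scale p a)"
    by (simp add: scale_left_distrib[symmetric])
  then have "prod_at h (scale (pCons c p) a) b =
      scale [:c:] (prod_at h a b) + prod_at h (scale [:0, 1:] (scale p a)) b"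
    by (simp only: additive.add[OF additive_prod_at_left] prod_at_const_left)
  also have "prod_at h (scale [:0, 1:] (scale p a)) b = - scale h (prod_at h (scale p a) b)"
    by (simp add: prod_at_def sesqui_left additive.minus[OF additive_eval_at] eval_at_pCons
             del: scale_scale)
  finally show ?case
    by (simp add: pCons.IH pcompose_pCons scale_left_diff_distrib)
qed

lemma eval2_at_subst_lambda:
  "eval2_at l m (subst_lambda scale z q) = eval_at (poly (poly z [:m:]) l) q"
proof -
  have "eval2_at l m (subst_lambda scale z q) =
      (\<Sum>n\<le>degree q. scale (poly (poly z [:m:]) l ^ n) (coeff q n))"
    by (simp add: subst_lambda_def additive.sum[OF additive_eval2_at] eval2_at_poly2_scale
        eval2_at_const)
  then show ?thesis by (simp add: eval_via_def)
qed

text \<open>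
  The values \<open>l\<close> and \<open>m\<close> are constants because the monomials \<open>\<lambda>\<^sup>i \<mu>\<^sup>j\<close> of \<open>A\<close> and \<open>B\<close> have to
  pass through the product, which is \<open>k\<close>-bilinear but not \<open>H\<close>-bilinear.
\<close>

lemma eval2_at_prod:
  fixes l m :: 'k
  shows "eval2_at [:l:] [:m:] (A \<circ>[z] B) =
    prod_at (poly (poly z [:[:m:]:]) [:l:]) (eval2_at [:l:] [:m:] A) (eval2_at [:l:] [:m:] B)"
proof -
  let ?z = "poly (poly z [:[:m:]:]) [:l:]"
  have scalar: "poly (poly (lam ^ (i + k) * mu ^ (j + n)) [:[:m:]:]) [:l:] =
      [:m ^ j:] * ([:l ^ i:] * ([:m ^ n:] * [:l ^ k:]))" for i j k n
    by (simp add: lam_def mu_def poly_const_pow power_add ac_simps)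
  have ev: "eval2_at [:l:] [:m:] X =
      (\<Sum>j\<le>degree X. \<Sum>i\<le>degree (coeff X j). scale [:m ^ j:] (scale [:l ^ i:] (coeff (coeff X j) i)))" for X
    by (simp add: eval_via_def poly_const_pow scale_sum_right)
  have "eval2_at [:l:] [:m:] (A \<circ>[z] B) =
     (\<Sum>j\<le>degree A. \<Sum>i\<le>degree (coeff A j). \<Sum>n\<le>degree B. \<Sum>k\<le>degree (coeff B n).
        scale [:m ^ j:] (scale [:l ^ i:] (scale [:m ^ n:] (scale [:l ^ k:]
          (prod_at ?z (coeff (coeff A j) i) (coeff (coeff B n) k))))))"
    by (simp only: ext_prod_def additive.sum[OF additive_eval2_at] eval2_at_poly2_scale
        eval2_at_subst_lambda prod_at_def[symmetric] scalar scale_scale)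
  also have "\<dots> = (\<Sum>j\<le>degree A. \<Sum>i\<le>degree (coeff A j). scale [:m ^ j:] (scale [:l ^ i:]
      (prod_at ?z (coeff (coeff A j) i) (eval2_at [:l:] [:m:] B))))"
    by (simp only: ev[of B] additive.sum[OF additive_prod_at_right] prod_at_const_right
        scale_sum_right)
  also have "\<dots> = prod_at ?z (eval2_at [:l:] [:m:] A) (eval2_at [:l:] [:m:] B)"
    by (simp only: ev[of A] additive.sum[OF additive_prod_at_left] prod_at_const_left)
  finally show ?thesis .
qed

end

text \<open>
  On the right-hand side \<open>[:l - m, - 1:]\<close> is the value \<open>- \<partial> - (m - l)\<close> of \<open>- \<partial> - (\<mu> - \<lambda>)\<close>.
\<close>

lemma (in novikov_conformal_algebra) right_commutative_at:
  "prod_at [:m:] (prod_at [:l:] a b) c = prod_at [:l - m, - 1:] (prod_at [:l:] a c) b"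
proof -
  have z: "poly (poly lam [:[:m:]:]) [:l:] = [:l:]" "poly (poly mu [:[:m:]:]) [:l:] = [:m:]"
    "poly (poly (- del - (mu - lam)) [:[:m:]:]) [:l:] = [:l - m, - 1:]"
    by (simp_all add: lam_def mu_def del_def)
  show ?thesis
    using arg_cong[OF right_commutative[of a b c], of "eval2_at [:l:] [:m:]"]
    by (simp only: eval2_at_prod eval2_at_const z)
qed

section \<open>Extensions of a rank one algebra by the scalar module\<close>

lemma poly_map_poly_eval: "poly (map_poly (\<lambda>p. poly p x) q) y = poly (poly q [:y:]) x"
  for x :: "'a::comm_ring_1"
  by (induction q) (simp_all add: map_poly_pCons)

lemma module_split_scale:
  assumes "module sV" and "module sM"
  shows "module (split_scale sV sM)"
proof -
  interpret V: module sV by fact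
  interpret M: module sM by fact
  show ?thesis
    by unfold_locales
      (simp_all add: split_scale_def V.scale_right_distrib M.scale_right_distrib
        V.scale_left_distrib M.scale_left_distrib)
qed

locale rank_one_scalar_extension =
  conformal_extension "(*)" pV scalar_scale "\<lambda>_ _. 0" "\<lambda>_ _. 0" sE pE \<iota> \<pi>
  for pV :: "'k::field_char_0 poly \<Rightarrow> 'k poly \<Rightarrow> 'k poly poly"
    and sE :: "'k poly \<Rightarrow> 'e::ab_group_add \<Rightarrow> 'e"
    and pE :: "'e \<Rightarrow> 'e \<Rightarrow> 'e poly"
    and \<iota> :: "'k \<Rightarrow> 'e" and \<pi> :: "'e \<Rightarrow> 'k poly"
begin

sublocale \<iota>: module_hom scalar_scale sE \<iota>
  using hom_\<iota> by (simp add: conformal_hom_def)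

sublocale \<pi>: module_hom sE "(*)" \<pi>
  using hom_\<pi> by (simp add: conformal_hom_def)

lemma \<pi>_prod: "pV (\<pi> x) (\<pi> y) = map_poly \<pi> (pE x y)"
  using hom_\<pi> by (simp add: conformal_hom_def)

lemma \<pi>_\<iota> [simp]: "\<pi> (\<iota> m) = 0"
  using exact by auto

lemma prod_\<iota> [simp]: "pE x (\<iota> m) = 0" "pE (\<iota> m) x = 0"
  by (simp_all add: induced_left induced_right)

definition scalar_part :: "'e \<Rightarrow> 'e \<Rightarrow> 'k" where
  "scalar_part e x = inv \<iota> (x - sE (\<pi> x) e)"

text \<open>
  The splitting \<open>E = He \<oplus> M\<close> given by a preimage \<open>e\<close> of the generator; \<open>scalar_part e\<close> is the
  projection to \<open>M\<close>.
\<close>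

lemma decomposition:
  assumes "\<pi> e = 1"
  shows "sE (\<pi> x) e + \<iota> (scalar_part e x) = x"
proof -
  have "x - sE (\<pi> x) e \<in> range \<iota>"
    unfolding exact by (simp add: \<pi>.diff \<pi>.scale assms)
  then show ?thesis
    by (simp add: scalar_part_def f_inv_into_f)
qed

lemma scalar_part_unique:
  assumes "\<pi> e = 1"
  shows "scalar_part e (sE p e + \<iota> m) = m"
  by (simp add: scalar_part_def \<pi>.add \<pi>.scale assms inj_\<iota>)

lemma scalar_part_hom:
  assumes "\<pi> e = 1"
  shows "module_hom sE scalar_scale (scalar_part e)"
proof
  fix x y r
  have "x + y = (sE (\<pi> x) e + \<iota> (scalar_part e x)) + (sE (\<pi> y) e + \<iota> (scalar_part e y))"
    by (simp only: decomposition[OF assms])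
  also have "\<dots> = sE (\<pi> x + \<pi> y) e + \<iota> (scalar_part e x + scalar_part e y)"
    by (simp add: \<iota>.add E.scale_left_distrib)
  finally show "scalar_part e (x + y) = scalar_part e x + scalar_part e y"
    by (simp only: scalar_part_unique[OF assms])
  have "sE r x = sE r (sE (\<pi> x) e + \<iota> (scalar_part e x))"
    by (simp only: decomposition[OF assms])
  also have "\<dots> = sE (r * \<pi> x) e + \<iota> (scalar_scale r (scalar_part e x))"
    by (simp add: \<iota>.scale E.scale_right_distrib)
  finally show "scalar_part e (sE r x) = scalar_scale r (scalar_part e x)"
    by (simp only: scalar_part_unique[OF assms])
qed

text \<open>
  Both sides are sesqui-linear in \<open>p\<close> and \<open>q\<close>, and \<open>1\<close> generates \<open>k[\<partial>]\<close> under sums, scalars and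
  multiplication by \<open>\<partial>\<close>; hence a linear splitting that is multiplicative on the generator is
  multiplicative.
\<close>

lemma prod_lift:
  assumes mult: "pE e e = map_poly (\<lambda>p. sE p e) (pV 1 1)"
  shows "pE (sE p e) (sE q e) = map_poly (\<lambda>p. sE p e) (pV p q)"
proof -
  let ?s = "\<lambda>p. sE p e"
  have add: "map_poly ?s (P + Q) = map_poly ?s P + map_poly ?s Q" for P Q
    by (rule poly_eqI) (simp add: coeff_map_poly E.scale_left_distrib)
  have neg: "map_poly ?s (- P) = - map_poly ?s P" for P
    by (rule poly_eqI) (simp add: coeff_map_poly)
  have shift: "map_poly ?s (pCons 0 P) = pCons 0 (map_poly ?s P)" for P
    by (simp add: map_poly_pCons)
  have scale: "map_poly ?s (map_poly ((*) c) P) = map_poly (sE c) (map_poly ?s P)" for c P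
    by (rule poly_eqI) (simp add: coeff_map_poly)
  have split: "pCons c r = [:c:] * 1 + [:0, 1:] * r" for c :: 'k and r
    by simp
  have sE_split: "sE (pCons c r) e = sE [:c:] (sE 1 e) + sE [:0, 1:] (sE r e)" for c r
    by (subst split[of c r]) (simp only: E.scale_left_distrib E.scale_scale)
  have left: "pE (sE p e) e = map_poly ?s (pV p 1)"
  proof (induction p)
    case 0
    show ?case
      using E.lprod_add_left[of 0 0 e] V.lprod_add_left[of 0 0 1] by simp
  next
    case (pCons c p)
    show ?case
      by (subst sE_split[of c p], subst split[of c p])
        (simp only: E.lprod_add_left V.lprod_add_left E.lprod_const_left V.lprod_const_left
          E.sesqui_left V.sesqui_left add neg shift scale pCons.IH E.scale_one mult)
  qed
  show ?thesis
  proof (induction q)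
    case 0
    show ?case
      using E.lprod_add_right[of "sE p e" 0 0] V.lprod_add_right[of p 0 0] by simp
  next
    case (pCons c q)
    show ?case
      by (subst sE_split[of c q], subst split[of c q])
        (simp only: E.lprod_add_right V.lprod_add_right E.lprod_const_right V.lprod_const_right
          E.sesqui_right V.sesqui_right add shift scale pCons.IH E.scale_one left)
  qed
qed

lemma trivial_if_multiplicative_lift:
  assumes lift: "\<pi> e = 1" and mult: "pE e e = map_poly (\<lambda>p. sE p e) (pV 1 1)"
  shows "trivial_extension (*) pV scalar_scale (\<lambda>_ _. 0) (\<lambda>_ _. 0) sE pE \<iota> \<pi>"
proof -
  define \<phi> where "\<phi> x = (\<pi> x, scalar_part e x)" for x
  interpret \<rho>: module_hom sE scalar_scale "scalar_part e"
    by (rule scalar_part_hom) fact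
  have \<phi>_lift: "\<phi> (sE p e + \<iota> m) = (p, m)" for p m
    by (simp add: \<phi>_def scalar_part_unique lift \<pi>.add \<pi>.scale)
  have "bij \<phi>"
  proof (rule bij_betw_byWitness[where f' = "\<lambda>(p, m). sE p e + \<iota> m"])
    show "\<forall>x\<in>UNIV. (\<lambda>(p, m). sE p e + \<iota> m) (\<phi> x) = x"
      by (simp add: \<phi>_def decomposition lift)
  qed (auto simp: \<phi>_lift)
  moreover have "module_hom sE (split_scale (*) scalar_scale) \<phi>"
  proof (intro module_hom.intro module_hom_axioms.intro module_split_scale)
    show "module sE" "module ((*) :: 'k poly \<Rightarrow> _)" "module (scalar_scale :: 'k poly \<Rightarrow> _)"
      by (rule E.module_axioms V.module_axioms \<iota>.m1.module_axioms)+
    fix x y p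
    show "\<phi> (x + y) = \<phi> x + \<phi> y"
      by (simp add: \<phi>_def \<pi>.add \<rho>.add)
    show "\<phi> (sE p x) = split_scale (*) scalar_scale p (\<phi> x)"
      by (simp add: \<phi>_def split_scale_def \<pi>.scale \<rho>.scale)
  qed
  moreover have "split_prod pV (\<lambda>_ _. 0) (\<lambda>_ _. 0) (\<phi> x) (\<phi> y) = map_poly \<phi> (pE x y)" for x y
  proof -
    have "pE x y = pE (sE (\<pi> x) e + \<iota> (scalar_part e x)) (sE (\<pi> y) e + \<iota> (scalar_part e y))"
      by (simp add: decomposition lift)
    also have "\<dots> = map_poly (\<lambda>p. sE p e) (pV (\<pi> x) (\<pi> y))"
      by (simp add: E.lprod_add_left E.lprod_add_right prod_lift mult)
    finally have "map_poly \<phi> (pE x y) = map_poly (\<phi> \<circ> (\<lambda>p. sE p e)) (pV (\<pi> x) (\<pi> y))"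
      using \<phi>_lift[of 0 0] by (simp add: map_poly_map_poly zero_prod_def)
    moreover have "\<phi> \<circ> (\<lambda>p. sE p e) = (\<lambda>p. (p, 0))"
      using \<phi>_lift[of _ 0] by (simp add: fun_eq_iff)
    ultimately show ?thesis
      by (simp add: split_prod_def \<phi>_def)
  qed
  moreover have "\<phi> \<circ> \<iota> = (\<lambda>m. (0, m))"
    using \<phi>_lift[of 0] by (simp add: fun_eq_iff)
  moreover have "fst \<circ> \<phi> = \<pi>"
    by (simp add: fun_eq_iff \<phi>_def)
  ultimately show ?thesis
    unfolding trivial_extension_def equivalent_extensions_def conformal_hom_def by blast
qed

text \<open>
  The component in \<open>M\<close> of right commutativity for \<open>e, e, e\<close>.  The inner product
  \<open>e \<circ>\<^sub>(\<^sub>l\<^sub>) e\<close> enters only through its component \<open>w(\<partial>, l) e\<close>, where \<open>w = pV 1 1\<close>.  In a further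
  product \<open>\<circ>\<^sub>(\<^sub>g\<^sub>) e\<close> the factor \<open>w(\<partial>, l)\<close> comes out as \<open>w(- g, l)\<close>, and it acts on \<open>M\<close> by its
  value at \<open>\<partial> = 0\<close>.  The two sides are the cases \<open>g = m\<close> and \<open>g = - \<partial> - (m - l)\<close>.
\<close>

lemma cocycle_identity:
  fixes e :: 'e
  assumes lift: "\<pi> e = 1"
  defines "f \<equiv> map_poly (scalar_part e) (pE e e)"
  shows "poly (poly (pV 1 1) [:l:]) (- m) * poly f m =
         poly (poly (pV 1 1) [:l:]) (m - l) * poly f (l - m)"
proof -
  interpret \<rho>: module_hom sE scalar_scale "scalar_part e"
    by (rule scalar_part_hom) fact
  have \<pi>_prod_at: "\<pi> (E.prod_at [:l:] e e) = poly (pV 1 1) [:l:]"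
  proof -
    have "poly (pV 1 1) [:l:] = (\<Sum>n\<le>degree (pE e e). coeff (pV 1 1) n * [:l:] ^ n)"
      by (rule poly_altdef_upto)
        (simp add: \<pi>_prod[of e e, unfolded lift] map_poly_degree_leq)
    then show ?thesis
      by (simp add: E.prod_at_def E.eval_via_def \<pi>.sum \<pi>.scale \<pi>_prod[of e e, unfolded lift]
          coeff_map_poly mult.commute)
  qed
  have \<rho>_prod_at: "scalar_part e (E.prod_at g e e) = poly f (poly g 0)" for g
  proof -
    have "poly f (poly g 0) = (\<Sum>n\<le>degree (pE e e). coeff f n * poly g 0 ^ n)"
      by (rule poly_altdef_upto) (simp add: f_def map_poly_degree_leq)
    then show ?thesis
      by (simp add: E.prod_at_def E.eval_via_def \<rho>.sum \<rho>.scale f_def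
          coeff_map_poly mult.commute scalar_scale_def)
  qed
  have "E.prod_at g (E.prod_at [:l:] e e) e =
      sE (pcompose (poly (pV 1 1) [:l:]) (- g)) (E.prod_at g e e)" for g
  proof -
    have "E.prod_at g (E.prod_at [:l:] e e) e =
        E.prod_at g (sE (poly (pV 1 1) [:l:]) e) e + E.prod_at g (\<iota> (scalar_part e (E.prod_at [:l:] e e))) e"
      using decomposition[OF lift, of "E.prod_at [:l:] e e"]
        additive.add[OF E.additive_prod_at_left, of g] by (metis \<pi>_prod_at)
    also have "E.prod_at g (\<iota> k) e = 0" for k
      by (simp add: E.prod_at_def additive.zero[OF E.additive_eval_at])
    finally show ?thesis by (simp add: E.prod_at_scale_left)
  qed
  then have "scalar_part e (E.prod_at g (E.prod_at [:l:] e e) e) =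
      poly (poly (pV 1 1) [:l:]) (- poly g 0) * poly f (poly g 0)" for g
    by (simp add: \<rho>.scale \<rho>_prod_at scalar_scale_def poly_pcompose)
  from this[of "[:m:]"] this[of "[:l - m, - 1:]"] show ?thesis
    by (simp add: E.right_commutative_at[of m l e e e])
qed

text \<open>
  The first assumption says that \<open>v \<circ>\<^sub>(\<^sub>\<lambda>\<^sub>) v = h(\<partial> + \<lambda>) v\<close>.  Dependence on \<open>\<partial> + \<lambda>\<close> only is what
  makes the cocycle identity symmetric in the two independent values \<open>x = \<lambda> - \<mu>\<close> and \<open>m = \<mu>\<close>.
\<close>

theorem trivial_if_product_of_sum:
  assumes h: "\<And>t l. poly (poly (pV 1 1) [:l:]) t = poly h (t + l)" and "h \<noteq> 0"
  shows "trivial_extension (*) pV scalar_scale (\<lambda>_ _. 0) (\<lambda>_ _. 0) sE pE \<iota> \<pi>"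
proof -
  obtain e where lift: "\<pi> e = 1"
    using surj_\<pi> by (metis surjD)
  define f where "f = map_poly (scalar_part e) (pE e e)"
  have swap: "poly h x * poly f m = poly h m * poly f x" for x m
    using cocycle_identity[OF lift, of "x + m" m] by (simp add: h f_def)
  obtain x where x: "poly h x \<noteq> 0"
    using \<open>h \<noteq> 0\<close> by (metis poly_all_0_iff_0)
  define c where "c = poly f x / poly h x"
  have "poly f = poly (smult c h)"
    using swap[of x] x by (auto simp: c_def fun_eq_iff field_simps)
  then have f: "f = smult c h"
    by (simp add: poly_eq_poly_eq_iff)
  have "poly (map_poly (\<lambda>p. poly p 0) (pV 1 1)) = poly h"
    by (simp add: poly_map_poly_eval h fun_eq_iff)
  then have h0: "map_poly (\<lambda>p. poly p 0) (pV 1 1) = h"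
    by (simp add: poly_eq_poly_eq_iff)
  interpret \<rho>: module_hom sE scalar_scale "scalar_part e"
    by (rule scalar_part_hom) fact
  \<comment> \<open>Adding \<open>\<iota> c\<close> does not change the product, but it changes the lift of \<open>h(\<partial> + \<lambda>) v\<close> by \<open>c h(\<lambda>)\<close>.\<close>
  have "pE (e + \<iota> c) (e + \<iota> c) = map_poly (\<lambda>p. sE p (e + \<iota> c)) (pV 1 1)"
  proof (rule poly_eqI)
    fix n
    let ?w = "coeff (pV 1 1) n"
    have "\<pi> (coeff (pE e e) n) = ?w"
      using \<pi>_prod[of e e] by (simp add: lift coeff_map_poly)
    moreover have "scalar_part e (coeff (pE e e) n) = scalar_scale ?w c"
    proof -
      have "scalar_part e (coeff (pE e e) n) = coeff f n"
        by (simp add: f_def coeff_map_poly)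
      also have "\<dots> = c * poly ?w 0"
        by (simp add: f h0[symmetric] coeff_map_poly)
      finally show ?thesis by (simp add: scalar_scale_def mult.commute)
    qed
    ultimately have "coeff (pE e e) n = sE ?w e + \<iota> (scalar_scale ?w c)"
      using decomposition[OF lift, of "coeff (pE e e) n"] by simp
    then show "coeff (pE (e + \<iota> c) (e + \<iota> c)) n =
        coeff (map_poly (\<lambda>p. sE p (e + \<iota> c)) (pV 1 1)) n"
      by (simp add: E.lprod_add_left E.lprod_add_right coeff_map_poly \<iota>.scale
          E.scale_right_distrib)
  qed
  then show ?thesis
    by (rule trivial_if_multiplicative_lift[rotated]) (simp add: \<pi>.add lift)
qed

end

section \<open>The algebras \<open>Cur\<^sub>1\<close> and \<open>V\<^sub>\<alpha>\<close>\<close>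

theorem theorem6:
  fixes pV :: "'k::field_char_0 poly \<Rightarrow> 'k poly \<Rightarrow> 'k poly poly"
    and sE :: "'k poly \<Rightarrow> 'e::ab_group_add \<Rightarrow> 'e"
    and pE :: "'e \<Rightarrow> 'e \<Rightarrow> 'e poly"
    and \<iota> :: "'k \<Rightarrow> 'e" and \<pi> :: "'e \<Rightarrow> 'k poly"
  assumes "pV = Cur1_prod \<or> (\<exists>\<alpha>. pV = V_prod \<alpha>)"
    and "conformal_extension (*) pV scalar_scale (\<lambda>_ _. 0) (\<lambda>_ _. 0) sE pE \<iota> \<pi>"
  shows "trivial_extension (*) pV scalar_scale (\<lambda>_ _. 0) (\<lambda>_ _. 0) sE pE \<iota> \<pi>"
proof -
  interpret rank_one_scalar_extension pV sE pE \<iota> \<pi>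
    using assms(2) by (rule rank_one_scalar_extension.intro)
  have gen: "rank_one_prod w 1 1 = w" for w :: "'k poly poly"
  proof -
    have "[:[:1:]:] = (1 :: 'k poly poly)"
      by (simp add: one_pCons)
    then show ?thesis
      by (simp add: rank_one_prod_def)
  qed
  from assms(1) show ?thesis
  proof (elim disjE exE)
    assume "pV = Cur1_prod"
    then show ?thesis
      by (intro trivial_if_product_of_sum[of 1]) (simp_all add: Cur1_prod_def gen)
  next
    fix \<alpha>
    assume "pV = V_prod \<alpha>"
    then show ?thesis
      by (intro trivial_if_product_of_sum[of "[:\<alpha>, 1:]"]) (simp_all add: V_prod_def gen)
  qed
qed

end
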